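(* Let $(G,p,L)$ be a $\mathbb{Z}^d$-tensegrity. If $(G,p,L)$ has a fixed-lattice equilibrium stress $\omega:E\to\mathbb{R}$ such that $\dim\ker\mathcal{L}(G,\omega)=1$ and $\mathcal{L}(G,\omega)$ is positive semidefinite, then $(G,p,L)$ is fixed-lattice globally rigid.
   Context: Fix an integer $d\ge 1$. A $\mathbb{Z}^d$-gain graph $G=(V,E)$ consists of a finite nonempty vertex set $V$ and a finite set $E$ of edges, where an edge is an equivalence class of triples $(u,v,\gamma)\in V\times V\times\mathbb{Z}^d$ under the identification $(u,v,\gamma)\sim(v,u,-\gamma)$, and triples $(u,u,0)$ are not allowed. The edge is a loop if $u=v$. One representative of each edge is fixed; the notions below do not depend on this choice. A $\mathbb{Z}^d$-framework is a triple $(G,p,L)$ with $p:V\to\mathbb{R}^d$ and $L\in\mathbb{R}^{d\times d}$ an arbitrary real matrix (the lattice). Two frameworks $(G,p,L)$, $(G,q,L')$ are congruent if there are an orthogonal $d\times d$ matrix $M$ and $x\in\mathbb{R}^d$ with $q(v)=Mp(v)+x$ for all $v\in V$ and $L'=ML$. A $\mathbb{Z}^d$-tensegrity is a $\mathbb{Z}^d$-framework together with a partition $E=E_0\sqcup E_+\sqcup E_-$ (bars, cables, struts). $(G,p,L)$ dominates $(G,p',L')$ (same partition) if, for every $(u,v,\gamma)\in E$, $\|p(v)+L\gamma-p(u)\|$ is equal to (for bars), $\ge$ (for cables), $\le$ (for struts) $\|p'(v)+L'\gamma-p'(u)\|$. $(G,p,L)$ is fixed-lattice globally rigid if every tensegrity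 $(G,p',L)$ with the same lattice $L$ that it dominates is congruent to it. A fixed-lattice equilibrium stress of the tensegrity $(G,p,L)$ is $\omega:E\to\mathbb{R}$ that is proper, i.e. $\omega(e)\ge0$ for $e\in E_+$ and $\omega(e)\le0$ for $e\in E_-$, and satisfies, for each $x\in V$, $\sum\omega(e)(p(x)+L\gamma-p(u))=\mathbf{0}$, the sum being over non-loop edges $e$ at $x$ written as $e=(u,x,\gamma)$. $I(G)$ is the $|E|\times|V|$ matrix whose row for a non-loop edge $(u,v,\gamma)$ has $-1$ in column $u$, $+1$ in column $v$ and $0$ elsewhere, and whose row for a loop is zero. $\mathcal{L}(G,\omega)=I(G)^\top\,\mathrm{diag}(\omega)\,I(G)$. *)

theory Defs
  imports "HOL-Analysis.Analysis"
begin

(* The finite nonempty vertex set is the finite type 'v; the dimension d >= 1 is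
   the size of the finite index type 'd.  An edge is given by its fixed
   representative (u, v, gamma). *)
type_synonym ('v, 'd) gain_edge = "'v \<times> 'v \<times> (int ^ 'd)"

definition reverse_edge :: "('v, 'd::finite) gain_edge \<Rightarrow> ('v, 'd) gain_edge" where
  "reverse_edge = (\<lambda>(u, v, \<gamma>). (v, u, - \<gamma>))"

definition same_edge :: "('v, 'd::finite) gain_edge \<Rightarrow> ('v, 'd) gain_edge \<Rightarrow> bool" where
  "same_edge e f \<longleftrightarrow> f = e \<or> f = reverse_edge e"

(* E contains exactly one representative of each edge of the graph, so distinct
   members of E are inequivalent.  Loops and parallel edges are allowed. *)
definition gain_graph :: "('v::finite, 'd::finite) gain_edge set \<Rightarrow> bool" where
  "gain_graph E \<longleftrightarrow>
     finite E \<and>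
     (\<forall>u. (u, u, 0) \<notin> E) \<and>
     (\<forall>e\<in>E. \<forall>f\<in>E. same_edge e f \<longrightarrow> e = f)"

definition is_loop :: "('v, 'd) gain_edge \<Rightarrow> bool" where
  "is_loop = (\<lambda>(u, v, \<gamma>). u = v)"

type_synonym ('v, 'd) framework = "('v \<Rightarrow> real ^ 'd) \<times> (real ^ 'd ^ 'd)"

definition lattice_shift :: "real ^ 'd ^ 'd \<Rightarrow> int ^ 'd \<Rightarrow> real ^ 'd::finite" where
  "lattice_shift L \<gamma> = L *v (\<chi> i. real_of_int (\<gamma> $ i))"

definition edge_vector ::
    "('v, 'd::finite) framework \<Rightarrow> ('v, 'd) gain_edge \<Rightarrow> real ^ 'd" where
  "edge_vector = (\<lambda>(p, L) (u, v, \<gamma>). p v + lattice_shift L \<gamma> - p u)"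

definition framework_congruent :: "('v, 'd::finite) framework \<Rightarrow> ('v, 'd) framework \<Rightarrow> bool" where
  "framework_congruent = (\<lambda>(p, L) (q, L').
     \<exists>M x. orthogonal_matrix M \<and> (\<forall>v. q v = M *v p v + x) \<and> L' = M ** L)"

(* Bars, cables and struts partition the edges; any part may be empty. *)
definition tensegrity_graph ::
    "('v::finite, 'd::finite) gain_edge set \<Rightarrow> ('v, 'd) gain_edge set \<Rightarrow>
     ('v, 'd) gain_edge set \<Rightarrow> ('v, 'd) gain_edge set \<Rightarrow> bool" where
  "tensegrity_graph E bars cables struts \<longleftrightarrow>
     gain_graph E \<and> E = bars \<union> cables \<union> struts \<and>
     bars \<inter> cables = {} \<and> bars \<inter> struts = {} \<and> cables \<inter> struts = {}"

definition dominates ::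
    "('v, 'd::finite) gain_edge set \<Rightarrow> ('v, 'd) gain_edge set \<Rightarrow> ('v, 'd) gain_edge set \<Rightarrow>
     ('v, 'd) framework \<Rightarrow> ('v, 'd) framework \<Rightarrow> bool" where
  "dominates bars cables struts F F' \<longleftrightarrow>
     (\<forall>e\<in>bars. norm (edge_vector F e) = norm (edge_vector F' e)) \<and>
     (\<forall>e\<in>cables. norm (edge_vector F e) \<ge> norm (edge_vector F' e)) \<and>
     (\<forall>e\<in>struts. norm (edge_vector F e) \<le> norm (edge_vector F' e))"

definition fixed_lattice_globally_rigid ::
    "('v, 'd::finite) gain_edge set \<Rightarrow> ('v, 'd) gain_edge set \<Rightarrow> ('v, 'd) gain_edge set \<Rightarrow>
     ('v, 'd) framework \<Rightarrow> bool" where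
  "fixed_lattice_globally_rigid bars cables struts = (\<lambda>(p, L).
     \<forall>p'. dominates bars cables struts (p, L) (p', L) \<longrightarrow> framework_congruent (p, L) (p', L))"

definition proper_stress ::
    "('v, 'd) gain_edge set \<Rightarrow> ('v, 'd) gain_edge set \<Rightarrow>
     (('v, 'd) gain_edge \<Rightarrow> real) \<Rightarrow> bool" where
  "proper_stress cables struts \<omega> \<longleftrightarrow> (\<forall>e\<in>cables. \<omega> e \<ge> 0) \<and> (\<forall>e\<in>struts. \<omega> e \<le> 0)"

(* A non-loop edge at x is rewritten in the form (u, x, gamma): the stored
   representative is used if its second endpoint is x, its reversal otherwise. *)
definition equilibrium ::
    "('v, 'd::finite) gain_edge set \<Rightarrow> ('v, 'd) framework \<Rightarrow>
     (('v, 'd) gain_edge \<Rightarrow> real) \<Rightarrow> bool" where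
  "equilibrium E F \<omega> \<longleftrightarrow>
     (\<forall>x. (\<Sum>e\<in>{e\<in>E. \<not> is_loop e \<and> (fst e = x \<or> fst (snd e) = x)}.
             \<omega> e *\<^sub>R edge_vector F (if fst (snd e) = x then e else reverse_edge e)) = 0)"

definition fixed_lattice_equilibrium_stress ::
    "('v, 'd::finite) gain_edge set \<Rightarrow> ('v, 'd) gain_edge set \<Rightarrow> ('v, 'd) gain_edge set \<Rightarrow>
     ('v, 'd) framework \<Rightarrow> (('v, 'd) gain_edge \<Rightarrow> real) \<Rightarrow> bool" where
  "fixed_lattice_equilibrium_stress E cables struts F \<omega> \<longleftrightarrow>
     proper_stress cables struts \<omega> \<and> equilibrium E F \<omega>"

definition incidence :: "('v, 'd) gain_edge \<Rightarrow> 'v \<Rightarrow> real" where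
  "incidence = (\<lambda>(u, v, \<gamma>) x.
     if u = v then 0 else if x = u then - 1 else if x = v then 1 else 0)"

(* The entries of the product I(G)^T diag(omega) I(G).  The rows of I(G) are
   indexed by the set E, which may be empty, so the product is written out as a sum. *)
definition weighted_laplacian ::
    "('v::finite, 'd) gain_edge set \<Rightarrow> (('v, 'd) gain_edge \<Rightarrow> real) \<Rightarrow> real ^ 'v ^ 'v" where
  "weighted_laplacian E \<omega> = (\<chi> x y. \<Sum>e\<in>E. incidence e x * \<omega> e * incidence e y)"

definition matrix_kernel :: "real ^ 'n ^ 'm \<Rightarrow> (real ^ 'n) set" where
  "matrix_kernel A = {x. A *v x = 0}"

definition positive_semidefinite :: "real ^ 'n ^ 'n \<Rightarrow> bool" where
  "positive_semidefinite A \<longleftrightarrow> transpose A = A \<and> (\<forall>x. 0 \<le> x \<bullet> (A *v x))"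

end

theory Submission
  imports Defs
begin

text \<open>
  Let \<open>\<delta>\<close> be the displacement from \<open>p\<close> to a dominated placement \<open>p'\<close>. Since the lattice is
  fixed, the vector of an edge from \<open>u\<close> to \<open>v\<close> changes by \<open>\<delta> v - \<delta> u\<close>. Expanding the squared
  edge lengths, the stress-weighted energy changes by a term linear in \<open>\<delta>\<close>, which vanishes by
  equilibrium, plus the Laplacian form summed over the coordinates of \<open>\<delta>\<close>. Domination and
  properness make this change nonpositive, so by positive semidefiniteness every coordinate of
  \<open>\<delta>\<close> lies in the kernel of the Laplacian, which is spanned by the all-ones vector: the two
  placements differ by a translation.
\<close>

text \<open>A zero of a nonnegative quadratic form is a minimum, so the gradient, which by symmetry
  is twice \<open>A *v x\<close>, vanishes there. The proof tests this by moving from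
  \<open>x\<close> in the direction \<open>A *v x\<close>.\<close>

lemma symmetric_psd_null_imp_kernel:
  fixes A :: "real ^ 'n ^ 'n"
  assumes psd: "positive_semidefinite A" and null: "x \<bullet> (A *v x) = 0"
  shows "A *v x = 0"
proof -
  have sym: "transpose A = A" and nonneg: "\<And>z. 0 \<le> z \<bullet> (A *v z)"
    using psd by (auto simp: positive_semidefinite_def)
  define y where "y = A *v x"
  define b where "b = y \<bullet> y"
  define c where "c = y \<bullet> (A *v y)"
  \<comment> \<open>The exact minimiser of \<open>2 * t * b + t^2 * c\<close> would be
    \<open>- b / c\<close>. Adding 1 keeps the denominator positive when \<open>c = 0\<close>, and
    the value is still negative unless \<open>b = 0\<close>.\<close>
  define t where "t = - b / (c + 1)"
  have c: "c \<ge> 0"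
    using nonneg by (simp add: c_def)
  have "x \<bullet> (A *v y) = y \<bullet> y"
    unfolding y_def by (metis dot_lmul_matrix sym transpose_matrix_vector)
  then have "(x + t *\<^sub>R y) \<bullet> (A *v (x + t *\<^sub>R y)) = 2 * t * b + t\<^sup>2 * c"
    using null
    by (simp add: matrix_vector_right_distrib matrix_vector_mult_scaleR inner_add_left
        inner_add_right b_def c_def y_def[symmetric] power2_eq_square
        distrib_left)
  then have "0 \<le> 2 * t * b + t\<^sup>2 * c"
    using nonneg by metis
  also have "\<dots> = - (b\<^sup>2 * (c + 2)) / (c + 1)\<^sup>2"
    using c by (simp add: t_def divide_simps power2_eq_square) (simp add: algebra_simps)
  finally have "b\<^sup>2 * (c + 2) \<le> 0"
    using c by (simp add: divide_le_0_iff)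
  then have "b = 0"
    using c by (smt (verit) mult_pos_pos zero_less_power2)
  then show ?thesis
    by (simp add: b_def y_def)
qed

text \<open>Each row of the incidence matrix acts as a difference operator; for a loop both sides
  vanish. Vector values are allowed so that displacements are covered as well as real
  coordinates.\<close>

lemma incidence_sum:
  fixes f :: "'v::finite \<Rightarrow> 'a::real_vector"
  shows "(\<Sum>x\<in>UNIV. incidence (u, v, \<gamma>) x *\<^sub>R f x) = f v - f u"
proof (cases "u = v")
  case True
  then show ?thesis by (simp add: incidence_def)
next
  case False
  have "incidence (u, v, \<gamma>) x *\<^sub>R f x = (if x = v then f x else 0) - (if x = u then f x else 0)" for x
    using False by (auto simp: incidence_def)
  then show ?thesis
    by (simp add: sum_subtractf)
qed

lemma incidence_sum_nth:
  "(\<Sum>x\<in>UNIV. incidence e x * z $ x) = z $ fst (snd e) - z $ fst e"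
  using incidence_sum[of "fst e" "fst (snd e)" "snd (snd e)" "\<lambda>x. z $ x"] by simp

lemma laplacian_mult:
  "weighted_laplacian E \<omega> *v z =
     (\<chi> x. \<Sum>e\<in>E. incidence e x * \<omega> e * (z $ fst (snd e) - z $ fst e))"
proof -
  have "(\<Sum>y\<in>UNIV. (\<Sum>e\<in>E. incidence e x * \<omega> e * incidence e y) * z $ y)
      = (\<Sum>e\<in>E. incidence e x * \<omega> e * (z $ fst (snd e) - z $ fst e))" for x
    unfolding incidence_sum_nth[symmetric] sum_distrib_right sum_distrib_left
    by (subst sum.swap) (simp add: mult.assoc)
  then show ?thesis
    by (simp add: weighted_laplacian_def matrix_vector_mult_def)
qed

lemma laplacian_quadratic_form:
  "z \<bullet> (weighted_laplacian E \<omega> *v z) = (\<Sum>e\<in>E. \<omega> e * (z $ fst (snd e) - z $ fst e)\<^sup>2)"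
proof -
  have "z \<bullet> (weighted_laplacian E \<omega> *v z)
      = (\<Sum>e\<in>E. \<Sum>x\<in>UNIV. z $ x * (incidence e x * \<omega> e * (z $ fst (snd e) - z $ fst e)))"
    by (simp add: laplacian_mult inner_vec_def sum_distrib_left sum.swap[of _ UNIV E])
  also have "\<dots> = (\<Sum>e\<in>E. (\<Sum>x\<in>UNIV. incidence e x * z $ x) * (\<omega> e * (z $ fst (snd e) - z $ fst e)))"
    by (simp add: sum_distrib_left sum_distrib_right mult_ac)
  finally show ?thesis
    by (simp add: incidence_sum_nth power2_eq_square mult_ac)
qed

lemma laplacian_kernel_constant:
  assumes dim: "dim (matrix_kernel (weighted_laplacian E \<omega>)) = 1"
    and z: "weighted_laplacian E \<omega> *v z = 0"
  shows "z $ u = z $ v"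
proof -
  let ?K = "matrix_kernel (weighted_laplacian E \<omega>)"
  have one: "1 \<in> ?K"
    by (simp add: matrix_kernel_def laplacian_mult vec_eq_iff)
  \<comment> \<open>\<open>1\<close> is the all-ones vector: being nonzero, it alone is an
    independent set as large as the dimension of the kernel.\<close>
  have "?K \<subseteq> span {1}"
    by (rule card_ge_dim_independent) (use one dim in auto)
  then obtain c where "z = c *\<^sub>R 1"
    using z by (auto simp: matrix_kernel_def span_singleton)
  then show ?thesis by simp
qed

lemma edge_vector_reverse: "edge_vector F (reverse_edge e) = - edge_vector F e"
proof -
  have "lattice_shift L (- \<gamma>) = - lattice_shift L \<gamma>" for L :: "real ^ 'd ^ 'd" and \<gamma>
    by (simp add: lattice_shift_def matrix_vector_mult_def vec_eq_iff sum_negf)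
  then show ?thesis
    by (cases F; cases e) (simp add: edge_vector_def reverse_edge_def)
qed

text \<open>Reversing an edge at its first endpoint negates its vector, which is the entry -1 of the
  incidence row. Loops and edges not at \<open>x\<close> have entry 0, so the sum may run over all
  of \<open>E\<close>.\<close>

lemma equilibrium_iff_incidence:
  assumes "finite E"
  shows "equilibrium E F \<omega> \<longleftrightarrow>
     (\<forall>x. (\<Sum>e\<in>E. (\<omega> e * incidence e x) *\<^sub>R edge_vector F e) = 0)"
proof -
  have "(\<Sum>e\<in>{e\<in>E. \<not> is_loop e \<and> (fst e = x \<or> fst (snd e) = x)}.
          \<omega> e *\<^sub>R edge_vector F (if fst (snd e) = x then e else reverse_edge e))
      = (\<Sum>e\<in>E. (\<omega> e * incidence e x) *\<^sub>R edge_vector F e)" for x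
    by (rule sum.mono_neutral_cong_left)
      (auto simp: assms incidence_def is_loop_def edge_vector_reverse split: if_splits)
  then show ?thesis
    by (simp add: equilibrium_def)
qed

text \<open>Pair the equilibrium equation at each vertex \<open>x\<close> with
  \<open>\<delta> x\<close>, add over all vertices and exchange the sums: the incidence entries
  collect into the difference along each edge.\<close>

lemma equilibrium_virtual_work:
  fixes E :: "('v::finite, 'd::finite) gain_edge set"
  assumes fin: "finite E" and eq: "equilibrium E F \<omega>"
  shows "(\<Sum>e\<in>E. \<omega> e * (edge_vector F e \<bullet> (\<delta> (fst (snd e)) - \<delta> (fst e)))) = 0"
proof -
  have "\<omega> e * (edge_vector F e \<bullet> (\<delta> (fst (snd e)) - \<delta> (fst e)))
      = (\<Sum>x\<in>UNIV. ((\<omega> e * incidence e x) *\<^sub>R edge_vector F e) \<bullet> \<delta> x)"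
    for e :: "('v, 'd) gain_edge"
    using incidence_sum[of "fst e" "fst (snd e)" "snd (snd e)" \<delta>, symmetric]
    by (simp add: inner_sum_right sum_distrib_left mult.assoc)
  then have "(\<Sum>e\<in>E. \<omega> e * (edge_vector F e \<bullet> (\<delta> (fst (snd e)) - \<delta> (fst e))))
      = (\<Sum>x\<in>UNIV. (\<Sum>e\<in>E. (\<omega> e * incidence e x) *\<^sub>R edge_vector F e) \<bullet> \<delta> x)"
    by (simp add: inner_sum_left sum.swap[of _ E UNIV])
  also have "\<dots> = 0"
    using eq by (simp add: equilibrium_iff_incidence[OF fin])
  finally show ?thesis .
qed

lemma dominated_energy_le:
  assumes E: "E = bars \<union> cables \<union> struts" and stress: "proper_stress cables struts \<omega>"
    and dom: "dominates bars cables struts F F'"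
  shows "(\<Sum>e\<in>E. \<omega> e * (norm (edge_vector F' e))\<^sup>2) \<le> (\<Sum>e\<in>E. \<omega> e * (norm (edge_vector F e))\<^sup>2)"
proof (rule sum_mono)
  fix e assume "e \<in> E"
  then consider "e \<in> bars" | "e \<in> cables" | "e \<in> struts"
    using E by blast
  then show "\<omega> e * (norm (edge_vector F' e))\<^sup>2 \<le> \<omega> e * (norm (edge_vector F e))\<^sup>2"
  proof cases
    case 1
    then show ?thesis
      using dom by (simp add: dominates_def)
  next
    case 2
    then show ?thesis
      using stress dom by (simp add: proper_stress_def dominates_def mult_left_mono power_mono)
  next
    case 3
    then show ?thesis
      using stress dom by (simp add: proper_stress_def dominates_def mult_left_mono_neg power_mono)
  qed
qed

theorem theorem5p8:
  fixes E bars cables struts :: "('v::finite, 'd::finite) gain_edge set"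
    and p :: "'v \<Rightarrow> real ^ 'd"
    and L :: "real ^ 'd ^ 'd"
    and \<omega> :: "('v, 'd) gain_edge \<Rightarrow> real"
  assumes "tensegrity_graph E bars cables struts"
    and "fixed_lattice_equilibrium_stress E cables struts (p, L) \<omega>"
    and "dim (matrix_kernel (weighted_laplacian E \<omega>)) = 1"
    and "positive_semidefinite (weighted_laplacian E \<omega>)"
  shows "fixed_lattice_globally_rigid bars cables struts (p, L)"
proof -
  have E: "finite E" "E = bars \<union> cables \<union> struts"
    using assms(1) by (auto simp: tensegrity_graph_def gain_graph_def)
  have proper: "proper_stress cables struts \<omega>" and equil: "equilibrium E (p, L) \<omega>"
    using assms(2) by (auto simp: fixed_lattice_equilibrium_stress_def)
  have "framework_congruent (p, L) (q, L)"
    if dom: "dominates bars cables struts (p, L) (q, L)" for q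
  proof -
    define \<delta> where "\<delta> v = q v - p v" for v
    define \<Delta> where "\<Delta> e = \<delta> (fst (snd e)) - \<delta> (fst e)" for e :: "('v, 'd) gain_edge"
    \<comment> \<open>The \<open>i\<close>-th coordinates of the displacements form a vector indexed
      by vertices, on which the Laplacian can act.\<close>
    define z where "z i = (\<chi> v. \<delta> v $ i)" for i
    let ?A = "weighted_laplacian E \<omega>"
    let ?w = "edge_vector (p, L)"
    have "edge_vector (q, L) e = ?w e + \<Delta> e" for e
      by (cases e) (simp add: edge_vector_def \<Delta>_def \<delta>_def)
    then have "\<omega> e * (norm (edge_vector (q, L) e))\<^sup>2
        = \<omega> e * (norm (?w e))\<^sup>2 + 2 * (\<omega> e * (?w e \<bullet> \<Delta> e)) + \<omega> e * (norm (\<Delta> e))\<^sup>2" for e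
      by (simp add: power2_norm_eq_inner inner_add_left inner_add_right inner_commute algebra_simps)
    then have "(\<Sum>e\<in>E. \<omega> e * (norm (edge_vector (q, L) e))\<^sup>2)
        = (\<Sum>e\<in>E. \<omega> e * (norm (?w e))\<^sup>2) + 2 * (\<Sum>e\<in>E. \<omega> e * (?w e \<bullet> \<Delta> e))
          + (\<Sum>e\<in>E. \<omega> e * (norm (\<Delta> e))\<^sup>2)"
      by (simp add: sum.distrib sum_distrib_left)
    then have energy: "(\<Sum>e\<in>E. \<omega> e * (norm (\<Delta> e))\<^sup>2) \<le> 0"
      using dominated_energy_le[OF E(2) proper dom]
        equilibrium_virtual_work[OF E(1) equil, of \<delta>]
      by (simp add: \<Delta>_def)
    have "(norm (\<Delta> e))\<^sup>2 = (\<Sum>i\<in>UNIV. (z i $ fst (snd e) - z i $ fst e)\<^sup>2)" for e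
      unfolding power2_norm_eq_inner inner_vec_def
      by (simp add: \<Delta>_def z_def power2_eq_square)
    then have "(\<Sum>e\<in>E. \<omega> e * (norm (\<Delta> e))\<^sup>2) = (\<Sum>i\<in>UNIV. z i \<bullet> (?A *v z i))"
      by (simp add: laplacian_quadratic_form sum_distrib_left sum.swap[of _ E UNIV])
    moreover have nonneg: "z i \<bullet> (?A *v z i) \<ge> 0" for i
      using assms(4) by (simp add: positive_semidefinite_def)
    \<comment> \<open>The sum is nonpositive by \<open>energy\<close> and has nonnegative terms, so
      each term must vanish.\<close>
    ultimately have "(\<Sum>i\<in>UNIV. z i \<bullet> (?A *v z i)) = 0"
      using energy by (simp add: antisym sum_nonneg)
    then have "z i \<bullet> (?A *v z i) = 0" for i
      using nonneg by (simp add: sum_nonneg_eq_0_iff)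
    then have "?A *v z i = 0" for i
      by (rule symmetric_psd_null_imp_kernel[OF assms(4)])
    then have "z i $ u = z i $ v" for i u v
      by (rule laplacian_kernel_constant[OF assms(3)])
    then have "\<delta> u = \<delta> v" for u v
      by (simp add: z_def vec_eq_iff)
    \<comment> \<open>Since \<open>\<delta>\<close> is constant, its value at the arbitrary vertex
      \<open>undefined\<close> serves as the translation.\<close>
    then have "q v = mat 1 *v p v + \<delta> undefined" for v
      by (metis \<delta>_def add.commute diff_add_cancel matrix_vector_mul_lid)
    moreover have "orthogonal_matrix (mat 1 :: real ^ 'd ^ 'd)"
      by (rule orthogonal_matrix_id)
    ultimately show ?thesis
      unfolding framework_congruent_def by (auto intro!: exI[of _ "mat 1"])
  qed
  then show ?thesis
    by (simp add: fixed_lattice_globally_rigid_def)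
qed

end
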